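(* Let $\mathcal{F}=(V,g,p)$ be a $d$-dimensional geometric constraint system. If $\mathcal{F}$ is infinitesimally rigid, then $\mathcal{F}$ is rigid.
   Context: A $d$-dimensional geometric constraint system $\mathcal{F}=(V,g,p)$ consists of a vertex set $V=[n]=\{1,\dots,n\}$, a polynomial map $g:\mathbb{R}^{dn}\to\mathbb{R}^m$ whose components $g_1,\dots,g_m$ are (not necessarily homogeneous) real quadratic polynomials, and a map $p:V\to\mathbb{R}^d$. The map $g$ is required to be invariant under Euclidean isometries of $\mathbb{R}^d$: $g(Qx_1+\tau,\dots,Qx_n+\tau)=g(x_1,\dots,x_n)$ for every orthogonal $Q\in\mathbb{R}^{d\times d}$, every $\tau\in\mathbb{R}^d$ and all $x_1,\dots,x_n\in\mathbb{R}^d$. The map $p$, identified with the vector $(p(1),\dots,p(n))\in\mathbb{R}^{dn}$, is required to be a realization, i.e. $g(p)=0$. Rigidity matrix: $R_{\mathcal{F}}(p)\in\mathbb{R}^{m\times dn}$ is the Jacobian matrix of $g$ at $p$, $R_{\mathcal{F}}(p)=\left(\frac{\partial g_i}{\partial p_{jk}}(p)\right)_{i\in[m],\,(j,k)\in[n]\times[d]}$, where $p_{jk}$ is the $k$-th coordinate variable of vertex $j$. An infinitesimal flex is an element $\dot p=(\dot p_1,\dots,\dot p_n)\in\ker R_{\mathcal{F}}(p)\subseteq\mathbb{R}^{dn}$. It is trivial if there exist a skew-symmetric matrix $S\in\mathbb{R}^{d\times d}$ and a vector $\tau\in\mathbb{R}^d$ with $\dot p_i=S\,p(i)+\tau$ for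 all $i\in V$. $\mathcal{F}$ is infinitesimally rigid if every infinitesimal flex is trivial. Two maps $p,q:V\to\mathbb{R}^d$ are equivalent if $g(p)=g(q)$; they are congruent if additionally $\|p(i)-p(j)\|=\|q(i)-q(j)\|$ for all $1\le i<j\le n$. $\mathcal{F}$ is rigid if there is a neighborhood of $p$ in $\mathbb{R}^{dn}$ in which all realizations equivalent to $p$ are congruent to $p$. *)

theory Defs
  imports "HOL-Analysis.Analysis"
begin

text \<open>
  The vertex set \<open>V = [n]\<close> is a finite type \<open>'n\<close>, the coordinates are indexed by a finite type
  \<open>'d\<close>, and the \<open>m\<close> constraints by a finite type \<open>'m\<close>.  The space of configurations is
  \<open>real ^ ('n \<times> 'd)\<close>, whose coordinate \<open>(j, k)\<close> is the \<open>k\<close>-th coordinate of vertex \<open>j\<close>.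
\<close>

definition config :: "('n \<Rightarrow> real^'d) \<Rightarrow> real^('n::finite \<times> 'd::finite)" where
  "config p = (\<chi> jk. p (fst jk) $ snd jk)"

definition block :: "real^('n::finite \<times> 'd::finite) \<Rightarrow> 'n \<Rightarrow> real^'d" where
  "block x j = (\<chi> k. x $ (j, k))"

lemma block_config [simp]: "block (config p) = p"
  by (simp add: fun_eq_iff vec_eq_iff block_def config_def)

lemma config_block [simp]: "config (block x) = x"
  by (simp add: vec_eq_iff block_def config_def)

text \<open>Degree at most two; the quadratic part need not be nonzero.\<close>

definition quadratic_polynomial :: "(real^'a::finite \<Rightarrow> real) \<Rightarrow> bool" where
  "quadratic_polynomial f \<longleftrightarrow>
     (\<exists>(A :: real^'a^'a) (b :: real^'a) (c :: real). \<forall>x. f x = x \<bullet> (A *v x) + b \<bullet> x + c)"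

definition isometry_invariant :: "(real^('n::finite \<times> 'd::finite) \<Rightarrow> real^'m::finite) \<Rightarrow> bool" where
  "isometry_invariant g \<longleftrightarrow>
     (\<forall>(Q :: real^'d^'d) (\<tau> :: real^'d) (x :: 'n \<Rightarrow> real^'d).
        orthogonal_matrix Q \<longrightarrow> g (config (\<lambda>j. Q *v x j + \<tau>)) = g (config x))"

definition realization ::
    "(real^('n::finite \<times> 'd::finite) \<Rightarrow> real^'m::finite) \<Rightarrow> ('n \<Rightarrow> real^'d) \<Rightarrow> bool" where
  "realization g p \<longleftrightarrow> g (config p) = 0"

definition geometric_constraint_system ::
    "(real^('n::finite \<times> 'd::finite) \<Rightarrow> real^'m::finite) \<Rightarrow> ('n \<Rightarrow> real^'d) \<Rightarrow> bool" where
  "geometric_constraint_system g p \<longleftrightarrow>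
     (\<forall>i. quadratic_polynomial (\<lambda>x. g x $ i)) \<and> isometry_invariant g \<and> realization g p"

definition rigidity_matrix ::
    "(real^('n::finite \<times> 'd::finite) \<Rightarrow> real^'m::finite) \<Rightarrow> ('n \<Rightarrow> real^'d) \<Rightarrow> real^('n \<times> 'd)^'m" where
  "rigidity_matrix g p = jacobian g (at (config p))"

text \<open>The entries of the rigidity matrix are the partial derivatives of the components of \<open>g\<close>.\<close>

lemma quadratic_polynomial_differentiable:
  assumes "quadratic_polynomial f"
  shows "f differentiable (at x)"
proof -
  from assms obtain A b c where "\<And>x. f x = x \<bullet> (A *v x) + b \<bullet> x + c"
    unfolding quadratic_polynomial_def by blast
  then have f: "f = (\<lambda>x. x \<bullet> (A *v x) + b \<bullet> x + c)" by blast
  have "((*v) A) differentiable (at x)"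
    by (simp add: linear_imp_differentiable)
  then show ?thesis
    unfolding f by (intro differentiable_add differentiable_inner) auto
qed

lemma rigidity_matrix_entry:
  assumes "geometric_constraint_system g p"
  shows "((\<lambda>t. g (config p + t *\<^sub>R axis (j, k) 1) $ i)
            has_real_derivative rigidity_matrix g p $ i $ (j, k)) (at 0)"
proof -
  have comp: "(\<lambda>x. g x $ i) differentiable (at (config p))" for i
    using assms quadratic_polynomial_differentiable
    unfolding geometric_constraint_system_def by blast
  have "g differentiable (at (config p))"
    unfolding differentiable_componentwise_within[of g]
    using comp by (auto simp: Basis_vec_def inner_axis)
  then have g': "(g has_derivative frechet_derivative g (at (config p))) (at (config p))"
    by (simp add: frechet_derivative_works)
  define D where "D = frechet_derivative g (at (config p))"
  have lin: "linear D"
    using g' unfolding D_def by (rule has_derivative_linear)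
  have "((\<lambda>t. config p + t *\<^sub>R axis (j, k) 1) has_derivative (\<lambda>t. t *\<^sub>R axis (j, k) 1)) (at (0::real))"
    by (auto intro!: derivative_eq_intros)
  moreover have "(g has_derivative D) (at (config p + (0::real) *\<^sub>R axis (j, k) 1))"
    using g' by (simp add: D_def)
  ultimately have "((\<lambda>t. g (config p + t *\<^sub>R axis (j, k) 1)) has_derivative
      (\<lambda>t. D (t *\<^sub>R axis (j, k) 1))) (at (0::real))"
    by (rule has_derivative_compose)
  then have "((\<lambda>t. g (config p + t *\<^sub>R axis (j, k) 1) $ i) has_derivative
      (\<lambda>t. D (t *\<^sub>R axis (j, k) 1) $ i)) (at (0::real))"
    by (rule bounded_linear.has_derivative[OF bounded_linear_vec_nth])
  moreover have "(\<lambda>t. D (t *\<^sub>R axis (j, k) 1) $ i) = (*) (rigidity_matrix g p $ i $ (j, k))"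
    by (auto simp: fun_eq_iff rigidity_matrix_def jacobian_def matrix_def D_def[symmetric]
        linear_cmul[OF lin])
  ultimately show ?thesis
    unfolding has_field_derivative_def by metis
qed

definition infinitesimal_flex ::
    "(real^('n::finite \<times> 'd::finite) \<Rightarrow> real^'m::finite) \<Rightarrow> ('n \<Rightarrow> real^'d) \<Rightarrow> real^('n \<times> 'd) \<Rightarrow> bool" where
  "infinitesimal_flex g p v \<longleftrightarrow> rigidity_matrix g p *v v = 0"

definition trivial_flex :: "('n::finite \<Rightarrow> real^'d::finite) \<Rightarrow> real^('n \<times> 'd) \<Rightarrow> bool" where
  "trivial_flex p v \<longleftrightarrow>
     (\<exists>(S :: real^'d^'d) (\<tau> :: real^'d). transpose S = - S \<and> (\<forall>i. block v i = S *v p i + \<tau>))"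

definition infinitesimally_rigid ::
    "(real^('n::finite \<times> 'd::finite) \<Rightarrow> real^'m::finite) \<Rightarrow> ('n \<Rightarrow> real^'d) \<Rightarrow> bool" where
  "infinitesimally_rigid g p \<longleftrightarrow> (\<forall>v. infinitesimal_flex g p v \<longrightarrow> trivial_flex p v)"

definition equivalent_maps ::
    "(real^('n::finite \<times> 'd::finite) \<Rightarrow> real^'m::finite) \<Rightarrow> ('n \<Rightarrow> real^'d) \<Rightarrow> ('n \<Rightarrow> real^'d) \<Rightarrow> bool" where
  "equivalent_maps g p q \<longleftrightarrow> g (config p) = g (config q)"

definition congruent_maps ::
    "(real^('n::finite \<times> 'd::finite) \<Rightarrow> real^'m::finite) \<Rightarrow> ('n \<Rightarrow> real^'d) \<Rightarrow> ('n \<Rightarrow> real^'d) \<Rightarrow> bool" where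
  "congruent_maps g p q \<longleftrightarrow>
     equivalent_maps g p q \<and> (\<forall>i j. i \<noteq> j \<longrightarrow> norm (p i - p j) = norm (q i - q j))"

definition rigid ::
    "(real^('n::finite \<times> 'd::finite) \<Rightarrow> real^'m::finite) \<Rightarrow> ('n \<Rightarrow> real^'d) \<Rightarrow> bool" where
  "rigid g p \<longleftrightarrow>
     (\<exists>U. open U \<and> config p \<in> U \<and>
        (\<forall>q. config q \<in> U \<and> realization g q \<and> equivalent_maps g q p \<longrightarrow> congruent_maps g q p))"

end

theory Submission imports Defs begin

text \<open>
  Given a realization \<open>q\<close> near \<open>p\<close>, let \<open>c\<close> be the point closest to \<open>p\<close> in the orbit of \<open>q\<close> under
  Euclidean isometries.  Minimality makes \<open>h = c - p\<close> orthogonal to every trivial flex at \<open>p\<close>.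
  By infinitesimal rigidity the rigidity matrix \<open>R\<close> is injective on the orthogonal complement of
  the trivial flexes, so \<open>\<bar>R h\<bar> \<ge> e \<bar>h\<bar>\<close> there for some \<open>e > 0\<close>.  But \<open>g c = g q = 0 = g p\<close>
  gives \<open>\<bar>R h\<bar> = o(\<bar>h\<bar>)\<close>, and \<open>\<bar>h\<bar> \<le> \<bar>q - p\<bar>\<close> is small, so \<open>h = 0\<close>: the isometry takes \<open>q\<close> to \<open>p\<close>.
\<close>

section \<open>Configurations vertex by vertex\<close>

lemma block_add [simp]: "block (x + y) i = block x i + block y i"
  by (simp add: block_def vec_eq_iff)

lemma block_diff [simp]: "block (x - y) i = block x i - block y i"
  by (simp add: block_def vec_eq_iff)

lemma block_scaleR [simp]: "block (c *\<^sub>R x) i = c *\<^sub>R block x i"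
  by (simp add: block_def vec_eq_iff)

lemma config_eq_iff: "x = y \<longleftrightarrow> (\<forall>i. block x i = block y i)"
  by (auto simp: block_def vec_eq_iff)

lemma inner_block: "x \<bullet> y = (\<Sum>i\<in>UNIV. block x i \<bullet> block y i)"
  by (simp add: inner_vec_def block_def sum.cartesian_product flip: UNIV_Times_UNIV)

text \<open>\<open>Q\<close> is left arbitrary so that one operation serves both purposes: with
  \<open>Q\<close> orthogonal, \<open>move Q x + shift \<tau>\<close> is the image of
  \<open>x\<close> under an isometry; with \<open>Q\<close> skew-symmetric it is a trivial flex at
  \<open>x\<close>.\<close>

definition move :: "real^'d^'d \<Rightarrow> real^('n::finite \<times> 'd::finite) \<Rightarrow> real^('n \<times> 'd)" where
  "move Q x = config (\<lambda>i. Q *v block x i)"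

definition shift :: "real^'d \<Rightarrow> real^('n::finite \<times> 'd::finite)" where
  "shift \<tau> = config (\<lambda>_. \<tau>)"

definition orbit :: "real^('n::finite \<times> 'd::finite) \<Rightarrow> (real^('n \<times> 'd)) set" where
  "orbit x = {move Q x + shift \<tau> |Q \<tau>. orthogonal_matrix Q}"

lemma block_move [simp]: "block (move Q x) i = Q *v block x i"
  by (simp add: move_def)

lemma block_shift [simp]: "block (shift \<tau>) i = \<tau>"
  by (simp add: shift_def)

lemma linear_move: "linear (move Q)"
  by (auto intro!: linearI simp: config_eq_iff matrix_vector_right_distrib
      matrix_vector_mult_scaleR)

lemma linear_shift: "linear shift"
  by (auto intro!: linearI simp: config_eq_iff)

section \<open>Skew-symmetric matrices\<close>

lemma inner_matrix_transpose: "(A *v x) \<bullet> y = x \<bullet> (transpose A *v (y :: real^'n))"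
  by (metis dot_lmul_matrix vector_transpose_matrix inner_commute)

lemma transpose_scaleR: "transpose (t *\<^sub>R A) = t *\<^sub>R transpose (A :: real^'n^'m)"
  by (simp add: transpose_def vec_eq_iff)

lemma skew_matrix_inner:
  fixes S :: "real^'d^'d"
  assumes "transpose S = - S"
  shows "(S *v x) \<bullet> y = - (x \<bullet> (S *v y))"
proof -
  have "(S *v x) \<bullet> y = x \<bullet> (- S *v y)"
    by (simp add: inner_matrix_transpose assms)
  also have "- S *v y = - (S *v y)"
    by (simp add: vec_eq_iff matrix_vector_mult_def sum_negf)
  finally show ?thesis by simp
qed

lemma skew_matrix_inner_self:
  fixes S :: "real^'d^'d"
  assumes "transpose S = - S"
  shows "(S *v x) \<bullet> x = 0"
  using skew_matrix_inner[OF assms, of x x] by (simp add: inner_commute)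

lemma skew_matrix_move_inner:
  assumes "transpose S = - S"
  shows "move S x \<bullet> y = - (x \<bullet> move S y)"
  by (simp add: inner_block skew_matrix_inner[OF assms] sum_negf)

section \<open>Orbits under Euclidean isometries\<close>

text \<open>Orthogonality is a system of polynomial equations in the entries, hence a closed
  condition, and the rows are unit vectors, hence the set is bounded.\<close>

lemma compact_orthogonal_matrices: "compact {Q :: real^'d^'d. orthogonal_matrix Q}"
proof -
  have "closed {Q :: real^'d^'d. \<forall>i j. (\<Sum>k\<in>UNIV. Q $ k $ i * Q $ k $ j) = mat 1 $ i $ j}"
    by (intro closed_Collect_all closed_Collect_eq continuous_intros)
  moreover have "{Q :: real^'d^'d. orthogonal_matrix Q} =
      {Q. \<forall>i j. (\<Sum>k\<in>UNIV. Q $ k $ i * Q $ k $ j) = mat 1 $ i $ j}"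
    by (simp add: orthogonal_matrix vec_eq_iff matrix_matrix_mult_def transpose_def)
  ultimately have "closed {Q :: real^'d^'d. orthogonal_matrix Q}" by simp
  moreover have "norm Q \<le> real CARD('d)" if "orthogonal_matrix Q" for Q :: "real^'d^'d"
  proof -
    have "norm (Q $ i) = 1" for i
      using that by (metis orthogonal_matrix_orthonormal_rows row_def vec_nth_inverse)
    then show ?thesis
      using L2_set_le_sum[of UNIV "\<lambda>i. norm (Q $ i)"] by (simp add: norm_vec_def)
  qed
  then have "bounded {Q :: real^'d^'d. orthogonal_matrix Q}"
    by (auto simp: bounded_iff)
  ultimately show ?thesis by (simp add: compact_eq_bounded_closed)
qed

text \<open>The orbit is the sum of a compact set, the linear image of the orthogonal matrices, and
  the closed subspace of translations. Closedness ensures that a closest point exists.\<close>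

lemma closed_orbit:
  fixes x :: "real^('n::finite \<times> 'd::finite)"
  shows "closed (orbit x)"
proof -
  have "linear (\<lambda>Q. move Q x)"
    by (auto intro!: linearI simp: config_eq_iff matrix_vector_mult_add_rdistrib
        scaleR_matrix_vector_assoc)
  then have "compact ((\<lambda>Q. move Q x) ` {Q. orthogonal_matrix Q})"
    by (intro compact_continuous_image compact_orthogonal_matrices linear_continuous_on)
       (simp add: linear_conv_bounded_linear)
  moreover have "closed (range (shift :: real^'d \<Rightarrow> real^('n \<times> 'd)))"
    by (intro closed_subspace linear_subspace_image[OF linear_shift]) simp
  ultimately have "closed (\<Union>y\<in>(\<lambda>Q. move Q x) ` {Q. orthogonal_matrix Q}.
      \<Union>z\<in>range shift. {y + z})"
    by (rule compact_closed_sums)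
  moreover have "(\<Union>y\<in>(\<lambda>Q. move Q x) ` {Q. orthogonal_matrix Q}.
      \<Union>z\<in>range shift. {y + z}) = orbit x"
    by (auto simp: orbit_def)
  ultimately show ?thesis by simp
qed

lemma orbit_refl: "x \<in> orbit x"
proof -
  have "x = move (mat 1) x + shift 0"
    by (simp add: config_eq_iff)
  then show ?thesis
    unfolding orbit_def using orthogonal_matrix_id by blast
qed

text \<open>Isometries compose. This allows competitors of a closest point \<open>c\<close> to be
  built from \<open>c\<close> itself.\<close>

lemma orbit_move_shift:
  assumes "c \<in> orbit x" "orthogonal_matrix Q"
  shows "move Q c + shift \<tau> \<in> orbit x"
proof -
  obtain P \<sigma> where P: "orthogonal_matrix P" "c = move P x + shift \<sigma>"
    using assms(1) by (auto simp: orbit_def)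
  have "move Q c + shift \<tau> = move (Q ** P) x + shift (Q *v \<sigma> + \<tau>)"
    by (simp add: P(2) config_eq_iff matrix_vector_mul_assoc matrix_vector_right_distrib)
  then show ?thesis
    unfolding orbit_def using orthogonal_matrix_mul[OF assms(2) P(1)] by blast
qed

lemma isometry_invariant_orbit:
  assumes "isometry_invariant g" "c \<in> orbit x"
  shows "g c = g x"
proof -
  obtain Q \<tau> where Q: "orthogonal_matrix Q" and c: "c = move Q x + shift \<tau>"
    using assms(2) by (auto simp: orbit_def)
  have "c = config (\<lambda>i. Q *v block x i + \<tau>)"
    by (simp add: c config_eq_iff)
  then show ?thesis
    using assms(1) Q unfolding isometry_invariant_def by (metis config_block)
qed

lemma orbit_block_dist:
  assumes "c \<in> orbit x"
  shows "norm (block c i - block c j) = norm (block x i - block x j)"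
proof -
  obtain Q \<tau> where Q: "orthogonal_matrix Q" and c: "c = move Q x + shift \<tau>"
    using assms by (auto simp: orbit_def)
  have "block c i - block c j = Q *v (block x i - block x j)"
    by (simp add: c matrix_vector_mult_diff_distrib)
  moreover have "orthogonal_transformation ((*v) Q)"
    using Q by (simp add: orthogonal_transformation_matrix)
  ultimately show ?thesis
    by (simp add: orthogonal_transformation_norm)
qed

text \<open>The Cayley transform \<open>(I + S) (I - S)\<^sup>-\<^sup>1\<close>.\<close>

lemma cayley_transform:
  fixes S :: "real^'d^'d"
  assumes S: "transpose S = - S"
  obtains Q where "orthogonal_matrix Q" "\<And>x. Q *v (x - S *v x) = x + S *v x"
    "surj (\<lambda>x. x - S *v x)"
proof -
  define f where "f x = x - S *v x" for x
  define k where "k x = x + S *v x" for x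
  have lf: "linear f" and lk: "linear k"
    unfolding f_def k_def
    by (auto intro!: linearI simp: matrix_vector_right_distrib matrix_vector_mult_scaleR algebra_simps)
  \<comment> \<open>The cross term \<open>x \<bullet> (S *v x)\<close> vanishes, so both squared
    norms are the sum of those of \<open>x\<close> and \<open>S *v x\<close>.\<close>
  have nfk: "norm (k x) = norm (f x)" for x
    using skew_matrix_inner_self[OF S, of x]
    by (simp add: norm_eq_sqrt_inner f_def k_def algebra_simps inner_commute)
  have "x = 0" if "f x = 0" for x
  proof -
    have "f x \<bullet> x = x \<bullet> x"
      using skew_matrix_inner_self[OF S, of x] by (simp add: f_def algebra_simps)
    with that show ?thesis by simp
  qed
  then have inj: "inj f" using lf by (simp add: linear_injective_0)
  then have surj: "surj f" using lf linear_injective_imp_surjective by blast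
  obtain f' where f': "linear f'" "f' \<circ> f = id"
    using linear_injective_left_inverse[OF lf inj] by blast
  have ff': "f (f' y) = y" for y
    using f'(2) surj by (metis comp_apply id_apply surjD)
  have "linear (k \<circ> f')" by (intro linear_compose f'(1) lk)
  moreover have "norm ((k \<circ> f') y) = norm y" for y
    by (simp add: nfk ff')
  ultimately have ot: "orthogonal_transformation (k \<circ> f')"
    by (simp add: orthogonal_transformation)
  show thesis
  proof
    show "orthogonal_matrix (matrix (k \<circ> f'))"
      using ot by (simp add: orthogonal_transformation_matrix)
    have "f' (f x) = x" for x using f'(2) by (metis comp_apply id_apply)
    then show "matrix (k \<circ> f') *v (x - S *v x) = x + S *v x" for x
      using \<open>linear (k \<circ> f')\<close> by (simp add: matrix_works flip: f_def k_def)
    show "surj (\<lambda>x. x - S *v x)" using surj by (simp add: f_def[abs_def])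
  qed
qed

section \<open>First-order conditions at a closest point of the orbit\<close>

text \<open>Translates of \<open>c\<close> stay in the orbit, so the squared distance to
  \<open>p\<close> along a translation is a quadratic in \<open>t\<close> with its minimum at 0; its
  linear coefficient must vanish.\<close>

lemma closest_point_orbit_shift:
  fixes c p x :: "real^('n::finite \<times> 'd::finite)"
  assumes min: "\<And>y. y \<in> orbit x \<Longrightarrow> norm (c - p) \<le> norm (y - p)" and c: "c \<in> orbit x"
  shows "(c - p) \<bullet> shift \<tau> = 0"
proof -
  define h where "h = c - p"
  have le: "norm h \<le> norm (h + t *\<^sub>R shift \<tau>)" for t
  proof -
    have "move (mat 1) c + shift (t *\<^sub>R \<tau>) = c + t *\<^sub>R shift \<tau>"
      by (simp add: config_eq_iff)
    then have "c + t *\<^sub>R shift \<tau> \<in> orbit x"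
      using orbit_move_shift[OF c orthogonal_matrix_id, of "t *\<^sub>R \<tau>"] by simp
    from min[OF this] show ?thesis
      by (simp add: h_def algebra_simps)
  qed
  let ?w = "shift \<tau> :: real^('n \<times> 'd)"
  show ?thesis
  proof (cases "?w = 0")
    case False
    then have w: "?w \<bullet> ?w > 0" by simp
    \<comment> \<open>The minimizer of the squared norm of
      \<open>h + t *\<^sub>R ?w\<close>.\<close>
    define t where "t = - (h \<bullet> ?w) / (?w \<bullet> ?w)"
    have "h \<bullet> h \<le> (h + t *\<^sub>R ?w) \<bullet> (h + t *\<^sub>R ?w)"
      using le[of t] by (simp add: norm_le)
    also have "\<dots> = h \<bullet> h - (h \<bullet> ?w)\<^sup>2 / (?w \<bullet> ?w)"
      using w by (simp add: t_def algebra_simps inner_commute power2_eq_square)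
    finally have "(h \<bullet> ?w)\<^sup>2 / (?w \<bullet> ?w) \<le> 0" by simp
    then have "(h \<bullet> ?w)\<^sup>2 \<le> 0" using w by (simp add: divide_le_0_iff)
    then show ?thesis by (simp add: h_def)
  qed simp
qed

text \<open>
  Comparing \<open>c = (I - t S) z\<close> with its image \<open>(I + t S) z\<close> under the Cayley transform gives
  \<open>S z \<bullet> p \<le> 0\<close>, where \<open>z \<rightarrow> c\<close> as \<open>t \<rightarrow> 0\<close>; this avoids differentiating a curve of rotations.
\<close>

lemma closest_point_orbit_skew_le:
  fixes c p x :: "real^('n::finite \<times> 'd::finite)"
  assumes min: "\<And>y. y \<in> orbit x \<Longrightarrow> norm (c - p) \<le> norm (y - p)" and c: "c \<in> orbit x"
    and S: "transpose S = - S"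
  shows "move S c \<bullet> p \<le> 0"
proof -
  obtain B where B: "B > 0" "\<And>y. norm (move S y :: real^('n \<times> 'd)) \<le> B * norm y"
    using linear_bounded_pos[OF linear_move[of S]] by metis
  \<comment> \<open>A bound, independent of \<open>t\<close>, for the error made when
    \<open>z\<close> is replaced by \<open>c\<close>.\<close>
  define K where "K = B * (B * norm c) * norm p"
  have "move S c \<bullet> p \<le> t * K" if t: "t > 0" for t
  proof -
    have "transpose (t *\<^sub>R S) = - (t *\<^sub>R S)"
      by (simp add: transpose_scaleR S)
    then obtain Q where Q: "orthogonal_matrix Q"
        "\<And>y. Q *v (y - t *\<^sub>R (S *v y)) = y + t *\<^sub>R (S *v y)"
        and surj: "surj (\<lambda>y. y - t *\<^sub>R (S *v y))"
      by (rule cayley_transform) (rule that[unfolded scaleR_matrix_vector_assoc])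
    define z where "z = config (\<lambda>i. inv (\<lambda>y. y - t *\<^sub>R (S *v y)) (block c i))"
    have "block c i = block z i - t *\<^sub>R (S *v block z i)" for i
      using surj_f_inv_f[OF surj, of "block c i"] by (simp add: z_def)
    then have c_eq: "c = z - t *\<^sub>R move S z"
      unfolding config_eq_iff by simp
    have "move Q c + shift 0 = z + t *\<^sub>R move S z"
      unfolding config_eq_iff by (simp add: c_eq Q(2))
    then have "z + t *\<^sub>R move S z \<in> orbit x"
      using orbit_move_shift[OF c Q(1), of 0] by simp
    from min[OF this] have "norm (z - t *\<^sub>R move S z - p) \<le> norm (z + t *\<^sub>R move S z - p)"
      using c_eq by simp
    moreover have zS: "z \<bullet> move S z = 0"
      using skew_matrix_move_inner[OF S, of z z] by (simp add: inner_commute)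
    \<comment> \<open>After squaring, only the terms linear in \<open>t\<close> differ, and in these
      \<open>z \<bullet> move S z\<close> drops out.\<close>
    ultimately have "t * (move S z \<bullet> p) \<le> 0"
      by (simp add: norm_le algebra_simps inner_commute)
    then have le0: "move S z \<bullet> p \<le> 0"
      using t by (simp add: mult_le_0_iff)
    have "move S z = move S c + t *\<^sub>R move S (move S z)"
    proof -
      have "z = c + t *\<^sub>R move S z" using c_eq by simp
      then have "move S z = move S (c + t *\<^sub>R move S z)" by simp
      then show ?thesis
        by (simp only: linear_add[OF linear_move] linear_cmul[OF linear_move])
    qed
    then have "move S z \<bullet> p = move S c \<bullet> p + t * (move S (move S z) \<bullet> p)"
      by (metis inner_add_left inner_scaleR_left)
    then have "move S c \<bullet> p \<le> t * - (move S (move S z) \<bullet> p)"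
      using le0 by simp
    also have "\<dots> \<le> t * K"
    proof (rule mult_left_mono)
      \<comment> \<open>Pythagoras for \<open>c = z - t *\<^sub>R move S z\<close>; the resulting
        bound on \<open>norm z\<close> does not involve \<open>t\<close>.\<close>
      have "c \<bullet> c = z \<bullet> z + (t *\<^sub>R move S z) \<bullet> (t *\<^sub>R move S z)"
        using zS unfolding c_eq by (simp add: algebra_simps inner_commute)
      then have "norm z \<le> norm c"
        using t by (simp add: norm_le zero_le_mult_iff)
      have "- (move S (move S z) \<bullet> p) \<le> norm (move S (move S z)) * norm p"
        using norm_cauchy_schwarz[of "- move S (move S z)" p] by simp
      also have "\<dots> \<le> (B * norm (move S z)) * norm p"
        using B by (intro mult_right_mono) auto
      also have "\<dots> \<le> (B * (B * norm z)) * norm p"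
        using B by (intro mult_right_mono mult_left_mono) auto
      also have "\<dots> \<le> K"
        unfolding K_def using B \<open>norm z \<le> norm c\<close> by (intro mult_right_mono mult_left_mono) auto
      finally show "- (move S (move S z) \<bullet> p) \<le> K" .
    qed (use t in simp)
    finally show ?thesis .
  qed
  then have "\<forall>\<^sub>F t in at_right 0. move S c \<bullet> p \<le> t * K"
    by (intro eventually_mono[OF eventually_at_right_less])
  moreover have "((\<lambda>t. t * K) \<longlongrightarrow> 0 * K) (at_right 0)"
    by (intro tendsto_intros)
  ultimately have "move S c \<bullet> p \<le> 0 * K"
    using tendsto_lowerbound[of "\<lambda>t. t * K" "0 * K" "at_right 0"] by simp
  then show ?thesis by simp
qed

text \<open>The inequality for both \<open>S\<close> and \<open>- S\<close> gives
  \<open>move S c \<bullet> config p = 0\<close>. Skewness moves \<open>S\<close> to the other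
  factor and also kills \<open>config p \<bullet> move S (config p)\<close>; translations are
  handled separately.\<close>

lemma closest_point_orbit_trivial_flex:
  assumes min: "\<And>y. y \<in> orbit x \<Longrightarrow> norm (c - config p) \<le> norm (y - config p)"
    and c: "c \<in> orbit x" and "trivial_flex p v"
  shows "(c - config p) \<bullet> v = 0"
proof -
  obtain S \<tau> where S: "transpose S = - S" and v: "\<And>i. block v i = S *v p i + \<tau>"
    using assms(3) unfolding trivial_flex_def by blast
  have v_eq: "v = move S (config p) + shift \<tau>"
    by (simp add: config_eq_iff v)
  have S': "transpose (- S) = - (- S)"
    using transpose_scaleR[of "-1" S] by (simp add: S)
  have "move (- S) c = - move S c"
    by (simp add: move_def config_def vec_eq_iff matrix_vector_mult_def sum_negf)
  then have "move S c \<bullet> config p = 0"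
    using closest_point_orbit_skew_le[OF min c S] closest_point_orbit_skew_le[OF min c S'] by simp
  moreover have "config p \<bullet> move S (config p) = 0"
    using skew_matrix_move_inner[OF S, of "config p" "config p"] by (simp add: inner_commute)
  ultimately have "(c - config p) \<bullet> move S (config p) = 0"
    using skew_matrix_move_inner[OF S, of c "config p"] by (simp add: inner_diff_left)
  then show ?thesis
    using closest_point_orbit_shift[OF min c, of \<tau>] by (simp add: v_eq inner_add_right)
qed

section \<open>Linearization of the constraints and conclusion\<close>

text \<open>Differentiability of the quadratic components ensures that the Jacobian matrix really
  represents the derivative.\<close>

lemma geometric_constraint_system_has_derivative:
  assumes "geometric_constraint_system g p"
  shows "(g has_derivative (*v) (rigidity_matrix g p)) (at (config p))"
proof -
  have "(\<lambda>x. g x $ i) differentiable (at (config p))" for i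
    using assms quadratic_polynomial_differentiable
    unfolding geometric_constraint_system_def by blast
  then have "g differentiable (at (config p))"
    unfolding differentiable_componentwise_within[of g]
    by (auto simp: Basis_vec_def inner_axis)
  then show ?thesis
    unfolding rigidity_matrix_def by (simp add: jacobian_works)
qed

theorem theorem2p5:
  fixes g :: "real^('n::finite \<times> 'd::finite) \<Rightarrow> real^'m::finite"
    and p :: "'n \<Rightarrow> real^'d"
  assumes "geometric_constraint_system g p"
    and "infinitesimally_rigid g p"
  shows "rigid g p"
proof -
  define R where "R = rigidity_matrix g p"
  define T where "T = {h. \<forall>v. trivial_flex p v \<longrightarrow> h \<bullet> v = 0}"
  have inv: "isometry_invariant g" and gp: "g (config p) = 0"
    using assms(1) by (auto simp: geometric_constraint_system_def realization_def)
  have "subspace T"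
    by (auto simp: T_def subspace_def inner_add_left)
  \<comment> \<open>Such an \<open>h\<close> is an infinitesimal flex, hence trivial, hence
    orthogonal to itself.\<close>
  moreover have "\<forall>h\<in>T. R *v h = 0 \<longrightarrow> h = 0"
    using assms(2) unfolding T_def R_def infinitesimally_rigid_def infinitesimal_flex_def
    by (metis (mono_tags, lifting) inner_eq_zero_iff mem_Collect_eq)
  ultimately obtain e where e: "e > 0" "\<forall>h\<in>T. e * norm h \<le> norm (R *v h)"
    using injective_imp_isometric[of T "(*v) R"] closed_subspace
      matrix_vector_mul_bounded_linear by (metis mult.commute)
  have "(g has_derivative (*v) R) (at (config p))"
    using geometric_constraint_system_has_derivative[OF assms(1)] by (simp add: R_def)
  \<comment> \<open>The tolerance \<open>e / 2\<close> lies strictly below the lower bound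
    \<open>e\<close>, so the two estimates are compatible only for a zero displacement.\<close>
  then obtain d where d: "d > 0" "\<And>y. norm (y - config p) < d \<Longrightarrow>
      norm (g y - g (config p) - R *v (y - config p)) \<le> e / 2 * norm (y - config p)"
    unfolding has_derivative_at_alt using e(1) by (meson half_gt_zero)
  have "congruent_maps g q p"
    if q: "norm (config q - config p) < d" "g (config q) = 0" for q
  proof -
    obtain c where c: "c \<in> orbit (config q)"
      and "\<And>y. y \<in> orbit (config q) \<Longrightarrow> dist (config p) c \<le> dist (config p) y"
      using distance_attains_inf[OF closed_orbit] orbit_refl by blast
    then have min: "norm (c - config p) \<le> norm (y - config p)" if "y \<in> orbit (config q)" for y
      using that by (simp add: dist_norm norm_minus_commute)
    have "c - config p \<in> T"
      using closest_point_orbit_trivial_flex[OF min c] by (simp add: T_def)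
    then have "e * norm (c - config p) \<le> norm (R *v (c - config p))"
      using e(2) by blast
    \<comment> \<open>Since \<open>config q\<close> lies in its own orbit, \<open>c\<close> is
      within \<open>d\<close> of \<open>config p\<close>; both values of \<open>g\<close> are 0, so
      only the linear term remains.\<close>
    also have "\<dots> \<le> e / 2 * norm (c - config p)"
      using d(2)[of c] min[OF orbit_refl] q gp isometry_invariant_orbit[OF inv c] by simp
    finally have "norm (c - config p) \<le> 0"
      using e(1) by simp
    then have "c = config p" by simp
    then have "norm (p i - p j) = norm (q i - q j)" for i j
      using orbit_block_dist[OF c, of i j] by simp
    then show ?thesis
      using q(2) gp by (simp add: congruent_maps_def equivalent_maps_def)
  qed
  then show ?thesis
    unfolding rigid_def realization_def using d(1)
    by (intro exI[of _ "ball (config p) d"]) (auto simp: dist_norm norm_minus_commute)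
qed

end
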